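(* Let $f,g:\mathbb{C}\to\mathbb{C}$ be holomorphic functions with $g'(z)\neq 0$, let $M^2\subset\mathbb{R}^3$ be the harmonic surface of graph type $$X(z)=\big(\langle 1,f(z)\rangle,\,g(z)\big),$$ considered where its Gaussian curvature is nonzero, and let $a,b\in\mathbb{R}$. Then $$N_1A_M=aX_1+b$$ if and only if there exist constants $z_1,z_2\in\mathbb{C}$ with $z_1\neq 0$, and $z_2\neq 0$ if $a=1$, and a constant $c\in\mathbb{R}$, such that (locally) $M^2$ is given by $X(z)=(\langle 1,f(z)\rangle,g(z))$ with $$f(z)=\begin{cases}\dfrac{\big(z_1g(z)+z_2\big)^{\frac{a}{a-1}}-b-ic}{a}, & a\in\mathbb{R}\setminus\{1,0\},\\[0.8em] z_1e^{z_2g(z)}-b-ic, & a=1,\\[0.4em] -(b+ic)\ln\big(z_1g(z)+z_2\big), & a=0.\end{cases}$$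
   Context: $\langle 1,w\rangle=\Re(w)$ for $w\in\mathbb{C}$, and $\mathbb{R}^3$ is identified with $\mathbb{R}\times\mathbb{C}$, so $X(z)=(\Re f(z),\Re g(z),\Im g(z))$ with $z=u+iv$. $A_M=\frac1{\kappa_1}+\frac1{\kappa_2}=\frac{2H}{K}$ is the sum of the principal radial curvatures ($\kappa_1,\kappa_2$ principal curvatures with respect to the unit normal $N$, with convention $N_{,i}=-\kappa_iX_{,i}$ along lines of curvature; $H$ mean curvature, $K$ Gaussian curvature). $X_1=\langle X,e_1\rangle=\Re f$ is the height function and $N_1=\langle N,e_1\rangle$ the angle function, with $N=\frac1D\big(|g'|^2,-g'\overline{f'}\big)$, $D=|g'|\sqrt{|g'|^2+|f'|^2}$. The logarithm and complex powers are understood on simply connected subdomains where a branch has been fixed. *)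

theory Defs
  imports "HOL-Complex_Analysis.Complex_Analysis"
begin

text \<open>Euclidean 3-space is \<^typ>\<open>real \<times> complex\<close>, with its product inner product;
  the parameter plane is \<^typ>\<open>complex\<close>.\<close>

definition e1 :: "real \<times> complex" where
  "e1 = (1, 0)"

definition harmonic_graph :: "(complex \<Rightarrow> complex) \<Rightarrow> (complex \<Rightarrow> complex) \<Rightarrow> complex \<Rightarrow> real \<times> complex" where
  "harmonic_graph f g z = (1 \<bullet> f z, g z)"

definition graph_normal :: "(complex \<Rightarrow> complex) \<Rightarrow> (complex \<Rightarrow> complex) \<Rightarrow> complex \<Rightarrow> real \<times> complex" where
  "graph_normal f g z =
     (let D = cmod (deriv g z) * sqrt ((cmod (deriv g z))\<^sup>2 + (cmod (deriv f z))\<^sup>2)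
      in (1 / D) *\<^sub>R ((cmod (deriv g z))\<^sup>2, - (deriv g z * cnj (deriv f z))))"

text \<open>Sign convention for principal curvatures: \<open>dN(v) = - \<kappa> dX(v)\<close> in a principal direction \<open>v\<close>.\<close>

definition principal_curvatures ::
  "(complex \<Rightarrow> real \<times> complex) \<Rightarrow> (complex \<Rightarrow> real \<times> complex) \<Rightarrow> complex \<Rightarrow> real set" where
  "principal_curvatures X N z =
     {\<kappa>. \<exists>v. v \<noteq> 0 \<and>
        frechet_derivative N (at z) v = - (\<kappa> *\<^sub>R frechet_derivative X (at z) v)}"

text \<open>For an immersed surface with smooth unit normal the shape operator is self-adjoint on a
  2-dimensional space, so the set above has two elements, or one at an umbilic; taking the
  least and the greatest element counts an umbilic value twice.\<close>

definition kappa1 ::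
  "(complex \<Rightarrow> real \<times> complex) \<Rightarrow> (complex \<Rightarrow> real \<times> complex) \<Rightarrow> complex \<Rightarrow> real" where
  "kappa1 X N z = Min (principal_curvatures X N z)"

definition kappa2 ::
  "(complex \<Rightarrow> real \<times> complex) \<Rightarrow> (complex \<Rightarrow> real \<times> complex) \<Rightarrow> complex \<Rightarrow> real" where
  "kappa2 X N z = Max (principal_curvatures X N z)"

definition gauss_curvature ::
  "(complex \<Rightarrow> real \<times> complex) \<Rightarrow> (complex \<Rightarrow> real \<times> complex) \<Rightarrow> complex \<Rightarrow> real" where
  "gauss_curvature X N z = kappa1 X N z * kappa2 X N z"

definition radial_curvature_sum ::
  "(complex \<Rightarrow> real \<times> complex) \<Rightarrow> (complex \<Rightarrow> real \<times> complex) \<Rightarrow> complex \<Rightarrow> real" where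
  "radial_curvature_sum X N z = 1 / kappa1 X N z + 1 / kappa2 X N z"

definition nonflat_points :: "(complex \<Rightarrow> complex) \<Rightarrow> (complex \<Rightarrow> complex) \<Rightarrow> complex set" where
  "nonflat_points f g = {z. gauss_curvature (harmonic_graph f g) (graph_normal f g) z \<noteq> 0}"

definition log_branch_on ::
  "complex set \<Rightarrow> (complex \<Rightarrow> complex) \<Rightarrow> (complex \<Rightarrow> complex) \<Rightarrow> bool" where
  "log_branch_on V \<phi> L \<longleftrightarrow> L holomorphic_on V \<and> (\<forall>z\<in>V. exp (L z) = \<phi> z)"

text \<open>\<open>P\<close> is a branch of the power of \<open>\<phi>\<close> with real exponent \<open>k\<close>. For \<open>k \<in> \<nat>\<close> the power is
  single-valued and makes sense also at zeros of \<open>\<phi>\<close>, where no logarithm exists. Such zeros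
  do occur at points of nonzero curvature, e.g. for \<open>f z = z\<^sup>2 / 2\<close>, \<open>g z = z\<close>, where
  \<open>k = 2\<close>.\<close>

definition power_branch_on ::
  "complex set \<Rightarrow> (complex \<Rightarrow> complex) \<Rightarrow> real \<Rightarrow> (complex \<Rightarrow> complex) \<Rightarrow> bool" where
  "power_branch_on V \<phi> k P \<longleftrightarrow>
     (\<exists>n::nat. k = real n \<and> (\<forall>z\<in>V. P z = \<phi> z ^ n)) \<or>
     (\<exists>L. log_branch_on V \<phi> L \<and> (\<forall>z\<in>V. P z = exp (of_real k * L z)))"

definition explicit_solution_on ::
  "real \<Rightarrow> real \<Rightarrow> complex \<Rightarrow> complex \<Rightarrow> real \<Rightarrow> (complex \<Rightarrow> complex) \<Rightarrow> (complex \<Rightarrow> complex)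
     \<Rightarrow> complex set \<Rightarrow> bool" where
  "explicit_solution_on a b z1 z2 c f g V \<longleftrightarrow>
     (if a = 0 then
        \<exists>L. log_branch_on V (\<lambda>z. z1 * g z + z2) L \<and>
            (\<forall>z\<in>V. f z = - (of_real b + \<i> * of_real c) * L z)
      else if a = 1 then
        \<forall>z\<in>V. f z = z1 * exp (z2 * g z) - of_real b - \<i> * of_real c
      else
        \<exists>P. power_branch_on V (\<lambda>z. z1 * g z + z2) (a / (a - 1)) P \<and>
            (\<forall>z\<in>V. f z = (P z - of_real b - \<i> * of_real c) / of_real a))"

end

theory Submission
  imports Defs
begin

text \<open>Where \<open>g\<close> is injective the surface is the graph of the real part of a holomorphic function of
\<open>w = g z\<close>. Put \<open>h = f' / g'\<close>, the derivative of \<open>f\<close> with respect to \<open>w\<close>. The unit normal is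
\<open>(1, - cnj h) / s\<close> with \<open>s\<^sup>2 = 1 + \<bar>h\<bar>\<^sup>2\<close>, and the shape operator is a real-linear map
\<open>v \<mapsto> \<alpha> v + \<beta> cnj v\<close> of the complex plane whose coefficients can be read off
(\<open>principal_curvatures_eq\<close>). Its trace and determinant give two facts: the nonflat points are those
with \<open>h' \<noteq> 0\<close>, and there \<open>N\<^sub>1 A\<^sub>M\<close> is the real part of the meromorphic function \<open>h\<^sup>2 g' / h'\<close>
(\<open>angle_times_radial_curvature_sum\<close>). The geometric equation therefore says that a holomorphic
function has real part zero on the nonflat set. This set is connected, being the plane minus the
zeros of an entire function, so the equation is equivalent to the complex one
\<open>h\<^sup>2 g' = h' Q\<close>, where \<open>Q = a f + b + i c\<close> for some real constant \<open>c\<close>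
(\<open>curvature_equation_iff_ode\<close>).

This second order equation has a first integral. As \<open>Q' = a h g'\<close>, it says
\<open>(Q / h)' = (a - 1) g'\<close>, that is, \<open>Q = h R\<close> with \<open>R = (a - 1) g + C\<close> (\<open>first_integral\<close>); conversely
\<open>Q = h R\<close> gives the equation back by differentiation (\<open>first_integral_imp_ode\<close>). Multiplied by
\<open>g'\<close>, the first integral is the linear equation \<open>R f' = g' Q\<close>, whose solutions are \<open>exp (- f / Q)\<close>
proportional to \<open>R\<close> for \<open>a = 0\<close> (then \<open>Q\<close> is constant), \<open>Q\<close> proportional to \<open>exp (g / C)\<close> for
\<open>a = 1\<close>, and \<open>Q\<close> proportional to \<open>R\<close> to the power \<open>k = a / (a - 1)\<close> otherwise.

The last case carries the one global difficulty, since \<open>R\<close> may vanish at nonflat points. If \<open>R\<close> has no zero,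
it has an entire logarithm and the power is defined on the whole plane. If \<open>R\<close> has a zero, it is a simple one, and comparing
leading coefficients in \<open>R Q' = k R' Q\<close> shows that \<open>k\<close> is the order of \<open>Q\<close> there, hence a
positive integer, so that the power is single-valued (\<open>entire_power_ode\<close>). In every case the
formula for \<open>f\<close> holds on all of the plane with one choice of constants.\<close>

section \<open>Real eigenvalues of real-linear maps of the complex plane\<close>

text \<open>The eigenvalue equation reads \<open>(\<kappa> - \<alpha>) v = \<beta> cnj v\<close>. Taking moduli gives the condition; if it
holds and \<open>\<beta> \<noteq> 0\<close>, then \<open>\<beta> / (\<kappa> - \<alpha>)\<close> lies on the unit circle, and a square root \<open>v\<close> of it satisfies
\<open>v / cnj v = v\<^sup>2\<close> and is an eigenvector.\<close>
lemma eigen_conj_linear: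
  fixes \<alpha> \<beta> :: complex and \<kappa> :: real
  shows "(\<exists>v. v \<noteq> 0 \<and> \<alpha> * v + \<beta> * cnj v = of_real \<kappa> * v) \<longleftrightarrow> cmod (of_real \<kappa> - \<alpha>) = cmod \<beta>"
proof
  assume "\<exists>v. v \<noteq> 0 \<and> \<alpha> * v + \<beta> * cnj v = of_real \<kappa> * v"
  then obtain v where v: "v \<noteq> 0" "\<alpha> * v + \<beta> * cnj v = of_real \<kappa> * v" by blast
  then have "(of_real \<kappa> - \<alpha>) * v = \<beta> * cnj v" by (simp add: algebra_simps)
  then have "cmod (of_real \<kappa> - \<alpha>) * cmod v = cmod \<beta> * cmod v"
    by (metis norm_mult complex_mod_cnj)
  with v show "cmod (of_real \<kappa> - \<alpha>) = cmod \<beta>" by simp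
next
  assume eq: "cmod (of_real \<kappa> - \<alpha>) = cmod \<beta>"
  show "\<exists>v. v \<noteq> 0 \<and> \<alpha> * v + \<beta> * cnj v = of_real \<kappa> * v"
  proof (cases "\<beta> = 0")
    case True
    with eq show ?thesis by (intro exI[of _ 1]) auto
  next
    case False
    define \<gamma> where "\<gamma> = of_real \<kappa> - \<alpha>"
    define v where "v = csqrt (\<beta> / \<gamma>)"
    have \<gamma>: "\<gamma> \<noteq> 0" "cmod \<gamma> = cmod \<beta>" using eq False by (auto simp: \<gamma>_def)
    have "v * v = \<beta> / \<gamma>" by (metis v_def power2_csqrt power2_eq_square)
    moreover have "cmod v = 1" using \<gamma> False by (simp add: v_def norm_divide)
    then have "v * cnj v = 1" by (simp add: complex_norm_square [symmetric])
    ultimately have "\<gamma> * v = \<beta> * cnj v"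
      using \<gamma> by (metis (no_types, lifting) mult.assoc mult.commute mult_1 nonzero_mult_div_cancel_left times_divide_eq_right)
    moreover have "v \<noteq> 0" using \<open>cmod v = 1\<close> by auto
    ultimately show ?thesis
      by (intro exI[of _ v]) (simp add: \<gamma>_def algebra_simps)
  qed
qed

lemma eigen_set_eq:
  fixes \<alpha> \<beta> :: complex
  assumes "cmod \<alpha> \<le> cmod \<beta>"
  defines "r \<equiv> sqrt ((cmod \<beta>)\<^sup>2 - (Im \<alpha>)\<^sup>2)"
  shows "{\<kappa>. cmod (of_real \<kappa> - \<alpha>) = cmod \<beta>} = {Re \<alpha> - r, Re \<alpha> + r}"
proof -
  have "(Im \<alpha>)\<^sup>2 \<le> (cmod \<beta>)\<^sup>2"
    using assms(1) abs_Im_le_cmod[of \<alpha>] by (metis abs_le_square_iff abs_norm_cancel order_trans)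
  then have r: "r\<^sup>2 = (cmod \<beta>)\<^sup>2 - (Im \<alpha>)\<^sup>2" by (simp add: r_def)
  have "cmod (of_real \<kappa> - \<alpha>) = cmod \<beta> \<longleftrightarrow> \<kappa> = Re \<alpha> - r \<or> \<kappa> = Re \<alpha> + r" for \<kappa>
  proof -
    have "cmod (of_real \<kappa> - \<alpha>) = cmod \<beta> \<longleftrightarrow> (cmod (of_real \<kappa> - \<alpha>))\<^sup>2 = (cmod \<beta>)\<^sup>2"
      by (simp add: power2_eq_iff_nonneg)
    also have "\<dots> \<longleftrightarrow> (\<kappa> - Re \<alpha>)\<^sup>2 = r\<^sup>2"
      by (auto simp: r cmod_power2[of "of_real \<kappa> - \<alpha>"])
    also have "\<dots> \<longleftrightarrow> \<kappa> = Re \<alpha> - r \<or> \<kappa> = Re \<alpha> + r"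
      unfolding power2_eq_iff by arith
    finally show ?thesis .
  qed
  then show ?thesis by blast
qed

text \<open>Trace and determinant of \<open>v \<mapsto> \<alpha> v + \<beta> cnj v\<close>, in terms of the least and the greatest
eigenvalue. For \<open>\<bar>\<alpha>\<bar> \<le> \<bar>\<beta>\<bar>\<close> the determinant is not positive, so both eigenvalues are real.\<close>
lemma eigen_Min_Max:
  fixes \<alpha> \<beta> :: complex
  assumes "cmod \<alpha> \<le> cmod \<beta>"
  defines "E \<equiv> {\<kappa>. cmod (of_real \<kappa> - \<alpha>) = cmod \<beta>}"
  shows "Min E + Max E = 2 * Re \<alpha>" "Min E * Max E = (cmod \<alpha>)\<^sup>2 - (cmod \<beta>)\<^sup>2"
proof -
  define r where "r = sqrt ((cmod \<beta>)\<^sup>2 - (Im \<alpha>)\<^sup>2)"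
  have "(Im \<alpha>)\<^sup>2 \<le> (cmod \<beta>)\<^sup>2"
    using assms(1) abs_Im_le_cmod[of \<alpha>] by (metis abs_le_square_iff abs_norm_cancel order_trans)
  then have r: "r \<ge> 0" "r\<^sup>2 = (cmod \<beta>)\<^sup>2 - (Im \<alpha>)\<^sup>2" by (simp_all add: r_def)
  have E: "E = {Re \<alpha> - r, Re \<alpha> + r}"
    unfolding E_def r_def by (rule eigen_set_eq[OF assms(1)])
  then have M: "Min E = Re \<alpha> - r" "Max E = Re \<alpha> + r"
    using r(1) by simp_all
  show "Min E + Max E = 2 * Re \<alpha>"
    unfolding M by simp
  show "Min E * Max E = (cmod \<alpha>)\<^sup>2 - (cmod \<beta>)\<^sup>2"
  proof -
    have "Min E * Max E = (Re \<alpha>)\<^sup>2 - r\<^sup>2"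
      unfolding M by (simp only: power2_eq_square square_diff_square_factored mult.commute)
    then show ?thesis unfolding r(2) cmod_power2[of \<alpha>] by simp
  qed
qed

section \<open>Entire functions determined by first order equations\<close>

text \<open>The zeros of an entire function that is not identically zero are countable, and a countable set
does not disconnect the plane.\<close>
lemma entire_nonzero_set:
  assumes "v holomorphic_on UNIV" "v p \<noteq> 0"
  shows "open {z. v z \<noteq> 0}" "connected {z. v z \<noteq> (0::complex)}"
proof -
  show "open {z. v z \<noteq> 0}"
    by (intro open_Collect_neq continuous_intros holomorphic_on_imp_continuous_on assms)
  show "connected {z. v z \<noteq> 0}"
  proof (cases "v constant_on UNIV")
    case True
    then have "{z. v z \<noteq> 0} = UNIV" using assms(2) by (auto simp: constant_on_def)
    then show ?thesis by (simp add: connected_UNIV)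
  next
    case False
    then have "countable {z \<in> UNIV. v z = 0}"
      using assms(1) by (intro holomorphic_countable_zeros) auto
    then have "connected (UNIV - {z. v z = 0})"
      by (intro connected_open_diff_countable) auto
    moreover have "UNIV - {z. v z = 0} = {z. v z \<noteq> 0}" by auto
    ultimately show ?thesis by simp
  qed
qed

text \<open>The hypothesis is \<open>(u / v)' = w'\<close> cleared of denominators. It integrates on the connected set where
\<open>v\<close> does not vanish, and the identity theorem carries the result across the zeros of \<open>v\<close>. With
\<open>w = 0\<close> this is the statement that functions with vanishing Wronskian are proportional.\<close>
lemma entire_quotient_primitive:
  assumes hol: "u holomorphic_on UNIV" "v holomorphic_on UNIV" "w holomorphic_on UNIV"
    and nz: "v p \<noteq> 0"
    and eq: "\<And>z. deriv u z * v z - u z * deriv v z = deriv w z * (v z)\<^sup>2"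
  obtains C where "\<And>z. u z = (w z + C) * v z"
proof -
  define S where "S = {z. v z \<noteq> 0}"
  have oS: "open S" and cS: "connected S"
    using entire_nonzero_set[OF hol(2) nz] by (simp_all add: S_def)
  have der: "(u has_field_derivative deriv u z) (at z)" "(v has_field_derivative deriv v z) (at z)"
      "(w has_field_derivative deriv w z) (at z)" for z
    using hol by (auto intro: holomorphic_derivI)
  obtain C where C: "\<And>z. z \<in> S \<Longrightarrow> u z / v z - w z = C"
  proof (rule DERIV_zero_connected_constant[OF cS oS finite.emptyI, of "\<lambda>z. u z / v z - w z"])
    show "continuous_on S (\<lambda>z. u z / v z - w z)"
      using hol by (intro continuous_intros holomorphic_on_imp_continuous_on)
         (auto simp: S_def elim: holomorphic_on_subset)
    show "\<forall>z\<in>S - {}. ((\<lambda>z. u z / v z - w z) has_field_derivative 0) (at z)"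
    proof
      fix z assume "z \<in> S - {}"
      then have z: "v z \<noteq> 0" by (simp add: S_def)
      show "((\<lambda>z. u z / v z - w z) has_field_derivative 0) (at z)"
        by (rule derivative_eq_intros der z refl)+
          (use z eq[of z] in \<open>simp add: field_simps power2_eq_square\<close>)
    qed
  qed blast
  have "u z = (w z + C) * v z" for z
  proof (rule analytic_continuation_open[of S UNIV u "\<lambda>z. (w z + C) * v z" z])
    show "S \<noteq> {}" using nz by (auto simp: S_def)
    show "u z = (w z + C) * v z" if "z \<in> S" for z
      using C[OF that] that by (auto simp: S_def field_simps)
  qed (auto intro!: holomorphic_intros hol oS)
  then show ?thesis by (rule that)
qed

text \<open>The real part of the derivative, applied to any direction, is zero; the direction conjugate to the
derivative gives its squared modulus.\<close>
lemma holomorphic_Re_zero_imp_const: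
  assumes "open S" "connected S" "f holomorphic_on S" "\<And>z. z \<in> S \<Longrightarrow> Re (f z) = 0"
  obtains c :: real where "\<And>z. z \<in> S \<Longrightarrow> f z = \<i> * of_real c"
proof -
  have "(f has_field_derivative 0) (at z)" if z: "z \<in> S" for z
  proof -
    have der: "(f has_field_derivative deriv f z) (at z)"
      using assms z by (auto intro: holomorphic_derivI)
    then have "((\<lambda>w. Re (f w)) has_derivative (\<lambda>h. Re (deriv f z * h))) (at z)"
      unfolding has_field_derivative_def by (intro derivative_eq_intros) auto
    moreover have "((\<lambda>w. Re (f w)) has_derivative (\<lambda>h. 0)) (at z)"
      by (rule has_derivative_transform_within_open[of "\<lambda>_. 0" _ _ _ S]) (use assms z in auto)
    ultimately have "(\<lambda>h. Re (deriv f z * h)) = (\<lambda>h. 0)"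
      by (rule has_derivative_unique)
    then have "Re (deriv f z * cnj (deriv f z)) = 0" by metis
    then have "deriv f z = 0" by (simp add: complex_mult_cnj complex_eq_iff)
    then show ?thesis using der by simp
  qed
  then obtain c where c: "\<And>z. z \<in> S \<Longrightarrow> f z = c"
    using DERIV_zero_connected_constant[OF assms(2,1) finite.emptyI, of f] assms(3)
      holomorphic_on_imp_continuous_on by (metis Diff_empty)
  show ?thesis
  proof (rule that)
    fix z assume "z \<in> S" then show "f z = \<i> * of_real (Im c)"
      using c assms(4)[of z] by (auto simp: complex_eq_iff)
  qed
qed

text \<open>As \<open>k\<close> and \<open>R'\<close> do not vanish, the equation makes \<open>\<xi>\<close> a zero of \<open>Q\<close>. Near it write \<open>R = (z - \<xi>) \<rho>\<close> and \<open>Q = (z - \<xi>)\<^sup>n q\<close> with \<open>q \<noteq> 0\<close>. After division by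
\<open>(z - \<xi>)\<^sup>n\<close> the equation becomes \<open>\<rho> (n q + (z - \<xi>) q') = k R' q\<close>, and at \<open>\<xi>\<close>, where
\<open>\<rho> = R' \<noteq> 0\<close>, this says \<open>n = k\<close>.\<close>
lemma power_ode_zero_exponent:
  fixes k :: complex
  assumes hol: "R holomorphic_on UNIV" "Q holomorphic_on UNIV"
    and R': "deriv R \<xi> \<noteq> 0" "R \<xi> = 0" and Qp: "Q p \<noteq> 0" and k: "k \<noteq> 0"
    and ode: "\<And>z. R z * deriv Q z = k * deriv R z * Q z"
  obtains n :: nat where "n > 0" "k = of_nat n"
proof -
  have Q0: "Q \<xi> = 0" using ode[of \<xi>] R' k by simp
  have nc: "\<not> Q constant_on UNIV"
  proof
    assume "Q constant_on UNIV"
    then obtain y where "\<forall>x\<in>UNIV. Q x = y" unfolding constant_on_def by blast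
    then have "Q p = Q \<xi>" by simp
    then show False using Q0 Qp by simp
  qed
  obtain q r n where n: "0 < n" and r: "0 < r" and q: "q holomorphic_on ball \<xi> r"
    and Q: "\<And>w. w \<in> ball \<xi> r \<Longrightarrow> Q w = (w - \<xi>) ^ n * q w"
    and q0: "\<And>w. w \<in> ball \<xi> r \<Longrightarrow> q w \<noteq> 0"
  proof (rule holomorphic_factor_zero_nonconstant[OF hol(2) open_UNIV connected_UNIV UNIV_I Q0 nc])
    fix q r n
    assume "0 < n" "0 < r" "ball \<xi> r \<subseteq> UNIV" "q holomorphic_on ball \<xi> r"
      "\<And>w. w \<in> ball \<xi> r \<Longrightarrow> Q w = (w - \<xi>) ^ n * q w"
      "\<And>w. w \<in> ball \<xi> r \<Longrightarrow> q w \<noteq> 0"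
    then show thesis by (intro that)
  qed
  \<comment> \<open>the removable singularity of \<open>R / (z - \<xi>)\<close> is filled in with the derivative\<close>
  define \<rho> where "\<rho> z = (if z = \<xi> then deriv R \<xi> else (R z - R \<xi>) / (z - \<xi>))" for z
  have \<rho>: "\<rho> holomorphic_on UNIV"
    unfolding \<rho>_def by (rule pole_lemma_open[OF hol(1) open_UNIV])
  have R_eq: "R z = (z - \<xi>) * \<rho> z" for z
    using R' by (simp add: \<rho>_def)
  have key: "\<rho> z * (of_nat n * q z + (z - \<xi>) * deriv q z) - k * deriv R z * q z = 0"
    if z: "z \<in> ball \<xi> r" "z \<noteq> \<xi>" for z
  proof -
    have dq: "(q has_field_derivative deriv q z) (at z)"
      using q z by (auto intro: holomorphic_derivI)
    have "((\<lambda>w. (w - \<xi>) ^ n * q w) has_field_derivative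
        of_nat n * (z - \<xi>) ^ (n - 1) * q z + (z - \<xi>) ^ n * deriv q z) (at z)"
      by (rule derivative_eq_intros dq refl | simp)+
    then have "(Q has_field_derivative
        of_nat n * (z - \<xi>) ^ (n - 1) * q z + (z - \<xi>) ^ n * deriv q z) (at z)"
      by (rule has_field_derivative_transform_within_open[OF _ open_ball z(1)]) (simp add: Q)
    then have Q': "deriv Q z = of_nat n * (z - \<xi>) ^ (n - 1) * q z + (z - \<xi>) ^ n * deriv q z"
      by (rule DERIV_imp_deriv)
    have pow: "(z - \<xi>) ^ n = (z - \<xi>) * (z - \<xi>) ^ (n - 1)"
      using n by (cases n) auto
    have ring: "Y * (s * (m * u + w * v)) = w * s * (m * X * u + Y * v)"
      if "Y = w * X" for Y X s m u v w :: complex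
      using that by algebra
    have "(z - \<xi>) ^ n * (\<rho> z * (of_nat n * q z + (z - \<xi>) * deriv q z)) = R z * deriv Q z"
      unfolding R_eq Q' by (rule ring[OF pow])
    also have "\<dots> = (z - \<xi>) ^ n * (k * deriv R z * q z)"
      unfolding ode Q[OF z(1)] by (simp add: mult_ac)
    finally show ?thesis using z(2) by simp
  qed
  let ?F = "\<lambda>z. \<rho> z * (of_nat n * q z + (z - \<xi>) * deriv q z) - k * deriv R z * q z"
  have "continuous_on (ball \<xi> r) ?F"
    by (intro holomorphic_on_imp_continuous_on holomorphic_intros q holomorphic_on_subset[OF \<rho>]
        holomorphic_deriv[OF q] holomorphic_on_subset[OF holomorphic_deriv[OF hol(1)]]) auto
  then have "isCont ?F \<xi>"
    using r by (simp add: continuous_on_eq_continuous_at)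
  moreover have "(?F \<longlongrightarrow> 0) (at \<xi>)"
  proof (rule tendsto_eventually, unfold eventually_at, intro exI conjI ballI impI)
    fix z assume "z \<noteq> \<xi> \<and> dist z \<xi> < r"
    then show "?F z = 0" by (intro key) (auto simp: dist_commute)
  qed (rule r)
  ultimately have "?F \<xi> = 0"
    unfolding isCont_def by (rule LIM_unique)
  then have "deriv R \<xi> * q \<xi> * (of_nat n - k) = 0"
    by (simp add: \<rho>_def algebra_simps)
  then have "k = of_nat n" using R' q0[of \<xi>] r by simp
  with n show ?thesis by (rule that)
qed

text \<open>If \<open>R\<close> has a zero, then \<open>k\<close> is a positive integer and \<open>Q\<close> is compared with \<open>R\<^sup>k\<close>; if not, \<open>R\<close> has an
entire logarithm \<open>L\<close> and \<open>Q\<close> is compared with \<open>exp (k L)\<close>. In both cases the factor of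
proportionality is absorbed into the base, which is possible because \<open>k \<noteq> 0\<close>.\<close>
lemma entire_power_ode:
  fixes k :: real and R Q :: "complex \<Rightarrow> complex"
  assumes hol: "R holomorphic_on UNIV" "Q holomorphic_on UNIV"
    and R': "\<And>z. deriv R z \<noteq> 0" and Qp: "Q p \<noteq> 0" and k: "k \<noteq> 0"
    and ode: "\<And>z. R z * deriv Q z = k * deriv R z * Q z"
  obtains l where "l \<noteq> 0" "power_branch_on UNIV (\<lambda>z. l * R z) k Q"
proof -
  have dR: "(R has_field_derivative deriv R z) (at z)" for z
    using hol by (auto intro: holomorphic_derivI)
  show ?thesis
  proof (cases "\<exists>\<xi>. R \<xi> = 0")
    case True
    then obtain \<xi> where \<xi>: "R \<xi> = 0" by blast
    obtain n where n: "n > 0" "complex_of_real k = of_nat n"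
      by (rule power_ode_zero_exponent[OF hol R' \<xi> Qp _ ode]) (use k in auto)
    then have kn: "k = real n" by (metis of_real_eq_iff of_real_of_nat_eq)
    have "\<exists>q. R q \<noteq> 0"
      using R'[of \<xi>] by (metis DERIV_imp_deriv DERIV_const ext)
    then obtain q where q: "R q \<noteq> 0" by blast
    obtain D where D: "\<And>z. Q z = (0 + D) * R z ^ n"
    proof (rule entire_quotient_primitive[OF hol(2), of "\<lambda>z. R z ^ n" "\<lambda>z. 0" q])
      fix z
      have 1: "deriv (\<lambda>z. R z ^ n) z = of_nat n * R z ^ (n - 1) * deriv R z"
        by (rule DERIV_imp_deriv) (rule derivative_eq_intros dR refl | simp)+
      have 2: "R z ^ n = R z * R z ^ (n - 1)" using n by (cases n) auto
      show "deriv Q z * R z ^ n - Q z * deriv (\<lambda>z. R z ^ n) z = deriv (\<lambda>z. 0) z * (R z ^ n)\<^sup>2"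
        unfolding 1 2 using ode[of z] n(2) by (simp add: algebra_simps)
    qed (use q in \<open>auto intro!: holomorphic_intros hol\<close>)
    have "D \<noteq> 0" using D[of p] Qp by auto
    \<comment> \<open>an \<open>n\<close>-th root of \<open>D\<close>\<close>
    let ?l = "exp (Ln D / of_nat n)"
    have "?l ^ n = D" using n \<open>D \<noteq> 0\<close> by (simp flip: exp_of_nat_mult)
    then have "power_branch_on UNIV (\<lambda>z. ?l * R z) k Q"
      unfolding power_branch_on_def using D by (auto simp: kn power_mult_distrib)
    then show ?thesis by (intro that[of ?l]) auto
  next
    case False
    then obtain L where L: "L holomorphic_on UNIV" "\<And>z. R z = exp (L z)"
      using contractible_imp_holomorphic_log[OF hol(1) contractible_UNIV] by auto
    have dL: "(L has_field_derivative deriv L z) (at z)" for z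
      using L by (auto intro: holomorphic_derivI)
    have R_deriv: "deriv R z = R z * deriv L z" for z
      unfolding L(2)[abs_def] by (rule DERIV_imp_deriv) (rule derivative_eq_intros dL refl)+
    let ?v = "\<lambda>z. exp (of_real k * L z)"
    obtain D where D: "\<And>z. Q z = (0 + D) * ?v z"
    proof (rule entire_quotient_primitive[OF hol(2), of ?v "\<lambda>z. 0" p])
      fix z
      have 1: "deriv ?v z = of_real k * deriv L z * ?v z"
        by (rule DERIV_imp_deriv) (rule derivative_eq_intros dL refl | simp)+
      have "deriv Q z = of_real k * deriv L z * Q z"
        using ode[of z] False by (simp add: R_deriv)
      then show "deriv Q z * ?v z - Q z * deriv ?v z = deriv (\<lambda>z. 0) z * (?v z)\<^sup>2"
        unfolding 1 by simp
    qed (auto intro!: holomorphic_intros L)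
    have "D \<noteq> 0" using D[of p] Qp by auto
    let ?l = "Ln D / of_real k"
    have "log_branch_on UNIV (\<lambda>z. exp ?l * R z) (\<lambda>z. ?l + L z)"
      unfolding log_branch_on_def by (auto intro!: holomorphic_intros L simp: exp_add L(2))
    moreover have "Q z = exp (of_real k * (?l + L z))" for z
      using D[of z] \<open>D \<noteq> 0\<close> k by (simp add: exp_add distrib_left)
    ultimately have "power_branch_on UNIV (\<lambda>z. exp ?l * R z) k Q"
      unfolding power_branch_on_def by blast
    then show ?thesis by (intro that[of "exp ?l"]) auto
  qed
qed

text \<open>In the form \<open>\<phi> P' = k \<phi>' P\<close>, free of division by \<open>\<phi>\<close>, the power rule holds for both kinds of branch,
also at zeros of \<open>\<phi>\<close>.\<close>
lemma power_branch_on_ode: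
  assumes "open V" "z \<in> V" and br: "power_branch_on V \<phi> k P"
    and d: "(\<phi> has_field_derivative \<phi>') (at z)"
  obtains P' where "(P has_field_derivative P') (at z)" "\<phi> z * P' = of_real k * \<phi>' * P z"
  using br unfolding power_branch_on_def
proof (elim disjE exE conjE)
  fix n :: nat
  assume k: "k = real n" and P: "\<forall>z\<in>V. P z = \<phi> z ^ n"
  have "((\<lambda>z. \<phi> z ^ n) has_field_derivative of_nat n * \<phi> z ^ (n - 1) * \<phi>') (at z)"
    by (rule derivative_eq_intros d refl)+ simp
  then have "(P has_field_derivative of_nat n * \<phi> z ^ (n - 1) * \<phi>') (at z)"
    by (rule has_field_derivative_transform_within_open[OF _ assms(1,2)]) (use P in auto)
  moreover have "\<phi> z * (of_nat n * \<phi> z ^ (n - 1) * \<phi>') = of_real k * \<phi>' * P z"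
    using P assms(2) by (cases n) (auto simp: k)
  ultimately show ?thesis by (rule that)
next
  fix L
  assume L: "log_branch_on V \<phi> L" and P: "\<forall>z\<in>V. P z = exp (of_real k * L z)"
  have dL: "(L has_field_derivative deriv L z) (at z)"
    using L assms by (auto simp: log_branch_on_def intro: holomorphic_derivI)
  have "((\<lambda>z. exp (L z)) has_field_derivative exp (L z) * deriv L z) (at z)"
    by (rule derivative_eq_intros dL refl)+
  then have "(\<phi> has_field_derivative exp (L z) * deriv L z) (at z)"
    by (rule has_field_derivative_transform_within_open[OF _ assms(1,2)])
      (use L in \<open>auto simp: log_branch_on_def\<close>)
  then have eq: "\<phi>' = \<phi> z * deriv L z"
    using DERIV_unique[OF d] L assms(2) by (auto simp: log_branch_on_def)
  have "((\<lambda>z. exp (of_real k * L z)) has_field_derivative exp (of_real k * L z) * (of_real k * deriv L z)) (at z)"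
    by (rule derivative_eq_intros dL refl)+ simp
  then have "(P has_field_derivative exp (of_real k * L z) * (of_real k * deriv L z)) (at z)"
    by (rule has_field_derivative_transform_within_open[OF _ assms(1,2)]) (use P in auto)
  moreover have "\<phi> z * (exp (of_real k * L z) * (of_real k * deriv L z)) = of_real k * \<phi>' * P z"
    using P assms(2) by (simp add: eq)
  ultimately show ?thesis by (rule that)
qed

section \<open>The shape operator of a harmonic graph\<close>

lemma Re_of_real_mult: "Re (of_real r * w) = r * Re w"
  by simp

locale immersed_graph =
  fixes f g :: "complex \<Rightarrow> complex"
  assumes f_hol: "f holomorphic_on UNIV" and g_hol: "g holomorphic_on UNIV"
    and g_imm: "\<And>z. deriv g z \<noteq> 0"
begin

text \<open>The derivative of \<open>f\<close> with respect to the local coordinate \<open>w = g z\<close>; its conjugate is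
  the gradient of the height as a function of \<open>w\<close>.\<close>
definition h :: "complex \<Rightarrow> complex" where "h z = deriv f z / deriv g z"

lemma h_hol: "h holomorphic_on UNIV"
  unfolding h_def using f_hol g_hol g_imm by (intro holomorphic_intros) auto

lemma surface_derivs:
  "(f has_field_derivative h z * deriv g z) (at z)"
  "(g has_field_derivative deriv g z) (at z)"
  "(h has_field_derivative deriv h z) (at z)"
  using f_hol g_hol h_hol g_imm by (auto intro!: holomorphic_derivI simp: h_def)

lemma graph_normal_eq:
  "graph_normal f g z = (1 / sqrt (1 + (cmod (h z))\<^sup>2)) *\<^sub>R (1, - cnj (h z))"
proof -
  let ?G = "cmod (deriv g z)" and ?s = "sqrt (1 + (cmod (h z))\<^sup>2)"
  have f: "deriv f z = h z * deriv g z" using g_imm[of z] by (simp add: h_def)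
  have G: "?G > 0" using g_imm by simp
  have "?G\<^sup>2 + (cmod (deriv f z))\<^sup>2 = ?G\<^sup>2 * (1 + (cmod (h z))\<^sup>2)"
    by (simp add: f norm_mult algebra_simps)
  then have D: "?G * sqrt (?G\<^sup>2 + (cmod (deriv f z))\<^sup>2) = ?G\<^sup>2 * ?s"
    using G by (simp add: real_sqrt_mult power2_eq_square)
  have c: "deriv g z * cnj (deriv f z) = of_real (?G\<^sup>2) * cnj (h z)"
    by (simp add: f complex_norm_square mult_ac flip: of_real_power)
  show ?thesis
    unfolding graph_normal_def Let_def D c using G
    by (simp add: scaleR_conv_of_real field_simps)
qed

lemma graph_has_derivative:
  "(harmonic_graph f g has_derivative (\<lambda>v. (Re (h z * deriv g z * v), deriv g z * v))) (at z)"
proof -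
  have "harmonic_graph f g = (\<lambda>z. (Re (f z), g z))"
    by (simp add: harmonic_graph_def fun_eq_iff inner_complex_def)
  then show ?thesis
    using has_derivative_Pair[OF has_derivative_Re surface_derivs(2)[of z, unfolded has_field_derivative_def],
        OF surface_derivs(1)[of z, unfolded has_field_derivative_def]]
    by (simp only:)
qed

lemma normal_has_derivative:
  fixes z :: complex
  defines "s \<equiv> sqrt (1 + (cmod (h z))\<^sup>2)"
  shows "(graph_normal f g has_derivative (\<lambda>v. 
     (- (h z \<bullet> (deriv h z * v)) / s ^ 3,
      of_real ((h z \<bullet> (deriv h z * v)) / s ^ 3) * cnj (h z) - cnj (deriv h z * v) / s))) (at z)"
proof -
  have N: "graph_normal f g = (\<lambda>z. (1 / sqrt (1 + h z \<bullet> h z), (1 / sqrt (1 + h z \<bullet> h z)) *\<^sub>R (- cnj (h z))))"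
    by (simp add: graph_normal_eq fun_eq_iff power2_norm_eq_inner)
  have pos: "1 + h z \<bullet> h z > 0" by (simp add: add_pos_nonneg)
  have s: "s = sqrt (1 + h z \<bullet> h z)" by (simp add: s_def power2_norm_eq_inner)
  have dh: "(h has_derivative (\<lambda>v. deriv h z * v)) (at z)"
    using surface_derivs(3) by (simp add: has_field_derivative_def)
  have ds: "((\<lambda>z. 1 / sqrt (1 + h z \<bullet> h z)) has_derivative (\<lambda>v. - (h z \<bullet> (deriv h z * v)) / s ^ 3)) (at z)"
  proof -
    have 1: "((\<lambda>z. 1 + h z \<bullet> h z) has_derivative (\<lambda>v. 2 * (h z \<bullet> (deriv h z * v)))) (at z)"
      by (rule derivative_eq_intros dh refl)+ (auto simp: inner_commute)
    have 2: "((\<lambda>t. 1 / sqrt t) has_field_derivative - 1 / (2 * s ^ 3)) (at (1 + h z \<bullet> h z))"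
      using pos by (auto intro!: derivative_eq_intros simp: s field_simps power3_eq_cube)
    show ?thesis
      using has_derivative_compose[OF 1 2[unfolded has_field_derivative_def]] by simp
  qed
  show ?thesis
    unfolding N
    by (rule has_derivative_eq_rhs[OF has_derivative_Pair[OF ds
          has_derivative_scaleR[OF ds has_derivative_minus[OF has_derivative_cnj[OF dh]]]]])
      (simp add: fun_eq_iff s scaleR_conv_of_real)
qed

text \<open>Both sides of the eigenvector equation are tangent vectors, hence determined by their complex
component \<open>T v\<close>; so the equation in three dimensions reduces to one in the plane. The coefficients
come from \<open>2 (h \<bullet> h' v) = cnj h h' v + h cnj (h' v)\<close> and \<open>s\<^sup>2 = 1 + h cnj h\<close>.\<close>
lemma principal_curvatures_eq:
  fixes z :: complex
  defines "s \<equiv> sqrt (1 + (cmod (h z))\<^sup>2)"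
  defines "\<alpha> \<equiv> - ((cnj (h z))\<^sup>2 * deriv h z) / (2 * of_real s ^ 3 * deriv g z)"
    and "\<beta> \<equiv> cnj (deriv h z) * (2 + of_real ((cmod (h z))\<^sup>2)) / (2 * of_real s ^ 3 * deriv g z)"
  shows "principal_curvatures (harmonic_graph f g) (graph_normal f g) z
           = {\<kappa>. cmod (of_real \<kappa> - \<alpha>) = cmod \<beta>}"
proof -
  have s: "s > 0" "s\<^sup>2 = 1 + (cmod (h z))\<^sup>2"
    by (auto simp: s_def add_pos_nonneg add_nonneg_nonneg)
  have sc: "complex_of_real s \<noteq> 0" "(complex_of_real s)\<^sup>2 = 1 + h z * cnj (h z)"
    using s by (auto simp: complex_norm_square simp flip: of_real_power)
  have n: "complex_of_real ((cmod (h z))\<^sup>2) = h z * cnj (h z)"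
    by (rule complex_norm_square)
  define A where "A v = h z \<bullet> (deriv h z * v)" for v
  have A: "2 * of_real (A v) = cnj (h z) * (deriv h z * v) + h z * cnj (deriv h z * v)" for v
    by (simp add: A_def inner_complex_def complex_eq_iff algebra_simps)
  \<comment> \<open>minus the complex component of the derivative of the normal\<close>
  define T where "T v = cnj (deriv h z * v) / s - of_real (A v / s ^ 3) * cnj (h z)" for v
  have T: "T v = deriv g z * (\<alpha> * v + \<beta> * cnj v)" for v
  proof -
    have "2 * of_real s ^ 3 * T v = 2 * of_real s ^ 2 * cnj (deriv h z * v) - 2 * of_real (A v) * cnj (h z)"
      using sc(1) by (simp add: T_def field_simps power2_eq_square power3_eq_cube)
    also have "\<dots> = (2 + h z * cnj (h z)) * cnj (deriv h z * v) - (cnj (h z))\<^sup>2 * deriv h z * v"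
      unfolding A sc(2) by (simp add: algebra_simps power2_eq_square)
    also have "\<dots> = 2 * of_real s ^ 3 * (deriv g z * (\<alpha> * v + \<beta> * cnj v))"
      using sc(1) g_imm[of z] unfolding \<alpha>_def \<beta>_def n by (simp add: field_simps)
    finally show ?thesis using sc(1) by simp
  qed
  have T1: "Re (h z * T v) = A v / s ^ 3" for v
  proof -
    have "Re (h z * T v) = Re (h z * cnj (deriv h z * v)) / s - A v / s ^ 3 * Re (h z * cnj (h z))"
      by (simp add: T_def algebra_simps add_divide_distrib diff_divide_distrib)
    also have "Re (h z * cnj (deriv h z * v)) = A v"
      by (simp add: A_def inner_complex_def algebra_simps)
    also have "Re (h z * cnj (h z)) = s\<^sup>2 - 1"
      by (simp add: s(2) flip: n)
    finally show ?thesis using s(1) by (simp add: field_simps power2_eq_square power3_eq_cube)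
  qed
  have dX: "frechet_derivative (harmonic_graph f g) (at z) = (\<lambda>v. (Re (h z * deriv g z * v), deriv g z * v))"
    using frechet_derivative_at[OF graph_has_derivative] by simp
  have dN: "frechet_derivative (graph_normal f g) (at z) = (\<lambda>v. (- (A v / s ^ 3), - T v))"
    using frechet_derivative_at[OF normal_has_derivative[of z]]
    by (simp add: A_def T_def s_def)
  have "frechet_derivative (graph_normal f g) (at z) v
          = - (\<kappa> *\<^sub>R frechet_derivative (harmonic_graph f g) (at z) v)
        \<longleftrightarrow> \<alpha> * v + \<beta> * cnj v = of_real \<kappa> * v" (is "?L \<longleftrightarrow> ?R") for \<kappa> v
  proof -
    \<comment> \<open>by \<open>T1\<close> the complex component implies the real one\<close>
    have "?L \<longleftrightarrow> A v / s ^ 3 = \<kappa> * Re (h z * deriv g z * v) \<and> T v = \<kappa> * (deriv g z * v)"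
      unfolding dX dN by (simp add: scaleR_conv_of_real)
    also have "\<dots> \<longleftrightarrow> T v = \<kappa> * (deriv g z * v)"
    proof (intro iffI conjI; (elim conjE)?)
      assume "T v = \<kappa> * (deriv g z * v)"
      then have "h z * T v = of_real \<kappa> * (h z * deriv g z * v)" by simp
      then show "A v / s ^ 3 = \<kappa> * Re (h z * deriv g z * v)"
        unfolding T1[symmetric] by (simp only: Re_of_real_mult)
    qed
    also have "\<dots> \<longleftrightarrow> ?R"
      unfolding T using g_imm[of z] by (simp add: mult_ac mult.left_commute[of _ "deriv g z"])
    finally show ?thesis .
  qed
  then show ?thesis
    by (simp add: principal_curvatures_def eigen_conj_linear)
qed

text \<open>The coefficients of the shape operator have moduli \<open>(s\<^sup>2 - 1) \<bar>p\<bar> / (2 s\<^sup>3)\<close> and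
\<open>(s\<^sup>2 + 1) \<bar>p\<bar> / (2 s\<^sup>3)\<close>; the difference of their squares is the determinant.\<close>
lemma curvature_sum_prod:
  fixes z :: complex
  defines "s \<equiv> sqrt (1 + (cmod (h z))\<^sup>2)" and "p \<equiv> deriv h z / deriv g z"
    and "k1 \<equiv> kappa1 (harmonic_graph f g) (graph_normal f g) z"
    and "k2 \<equiv> kappa2 (harmonic_graph f g) (graph_normal f g) z"
  shows "k1 + k2 = - Re ((cnj (h z))\<^sup>2 * p) / s ^ 3" "k1 * k2 = - (cmod p)\<^sup>2 / s ^ 4"
proof -
  define \<alpha> where "\<alpha> = - ((cnj (h z))\<^sup>2 * deriv h z) / (2 * of_real s ^ 3 * deriv g z)"
  define \<beta> where "\<beta> = cnj (deriv h z) * (2 + of_real ((cmod (h z))\<^sup>2)) / (2 * of_real s ^ 3 * deriv g z)"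
  have s: "s > 0" "(cmod (h z))\<^sup>2 = s\<^sup>2 - 1"
    by (simp_all add: s_def add_pos_nonneg)
  have E: "principal_curvatures (harmonic_graph f g) (graph_normal f g) z
           = {\<kappa>. cmod (of_real \<kappa> - \<alpha>) = cmod \<beta>}"
    unfolding \<alpha>_def \<beta>_def s_def by (rule principal_curvatures_eq)
  have a: "cmod \<alpha> = (s\<^sup>2 - 1) * cmod p / (2 * s ^ 3)"
    using s(1) by (simp add: \<alpha>_def p_def norm_mult norm_divide norm_power s(2))
  have "cmod (2 + of_real ((cmod (h z))\<^sup>2)) = s\<^sup>2 + 1"
  proof -
    have "cmod (of_real (2 + (cmod (h z))\<^sup>2)) = 2 + (cmod (h z))\<^sup>2"
      by (metis abs_of_nonneg add_nonneg_nonneg norm_of_real zero_le_numeral zero_le_power2)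
    then show ?thesis using s(2) by simp
  qed
  moreover have "cmod (2 * of_real s ^ 3) = 2 * s ^ 3"
    using s(1) by (simp add: norm_mult norm_power)
  ultimately have b: "cmod \<beta> = (s\<^sup>2 + 1) * cmod p / (2 * s ^ 3)"
    unfolding \<beta>_def p_def norm_mult norm_divide complex_mod_cnj by (simp add: mult.commute)
  have le: "cmod \<alpha> \<le> cmod \<beta>"
    unfolding a b using s(1) by (intro divide_right_mono mult_right_mono) auto
  have "k1 + k2 = 2 * Re \<alpha>"
    unfolding k1_def k2_def kappa1_def kappa2_def E by (rule eigen_Min_Max(1)[OF le])
  also have "\<alpha> = of_real (- 1 / (2 * s ^ 3)) * ((cnj (h z))\<^sup>2 * p)"
    by (simp add: \<alpha>_def p_def)
  also have "2 * Re \<dots> = - Re ((cnj (h z))\<^sup>2 * p) / s ^ 3"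
    unfolding Re_of_real_mult by (simp del: times_complex.sel)
  finally show "k1 + k2 = - Re ((cnj (h z))\<^sup>2 * p) / s ^ 3" .
  have "k1 * k2 = (cmod \<alpha>)\<^sup>2 - (cmod \<beta>)\<^sup>2"
    unfolding k1_def k2_def kappa1_def kappa2_def E by (rule eigen_Min_Max(2)[OF le])
  also have "\<dots> = ((s\<^sup>2 - 1)\<^sup>2 - (s\<^sup>2 + 1)\<^sup>2) * (cmod p)\<^sup>2 / (2 * s ^ 3)\<^sup>2"
    unfolding a b power_divide power_mult_distrib by (simp only: left_diff_distrib diff_divide_distrib)
  also have "(s\<^sup>2 - 1)\<^sup>2 - (s\<^sup>2 + 1)\<^sup>2 = - (4 * s\<^sup>2)"
    by (simp add: power2_eq_square algebra_simps)
  also have "- (4 * s\<^sup>2) * (cmod p)\<^sup>2 / (2 * s ^ 3)\<^sup>2 = - (cmod p)\<^sup>2 / s ^ 4"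
    using s(1) by (simp add: field_simps power2_eq_square eval_nat_numeral)
  finally show "k1 * k2 = - (cmod p)\<^sup>2 / s ^ 4" .
qed

lemma nonflat_points_eq: "nonflat_points f g = {z. deriv h z \<noteq> 0}"
proof -
  have quot: "- x\<^sup>2 / s ^ 4 = 0 \<longleftrightarrow> x = 0" if "s > 0" for s x :: real
    using that by simp
  have pos: "sqrt (1 + (cmod (h z))\<^sup>2) > 0" for z
    by (simp add: add_pos_nonneg)
  have "gauss_curvature (harmonic_graph f g) (graph_normal f g) z = 0 \<longleftrightarrow> deriv h z = 0" for z
    unfolding gauss_curvature_def curvature_sum_prod(2) quot[OF pos] using g_imm[of z] by simp
  then show ?thesis
    unfolding nonflat_points_def by blast
qed

text \<open>The quotient of trace and determinant of the shape operator contributes a factor \<open>s\<close>, which the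
angle function \<open>1 / s\<close> cancels.\<close>
lemma angle_times_radial_curvature_sum:
  assumes "deriv h z \<noteq> 0"
  shows "(graph_normal f g z \<bullet> e1) * radial_curvature_sum (harmonic_graph f g) (graph_normal f g) z
          = Re ((h z)\<^sup>2 * deriv g z / deriv h z)"
proof -
  define s where "s = sqrt (1 + (cmod (h z))\<^sup>2)"
  define p where "p = deriv h z / deriv g z"
  define k1 where "k1 = kappa1 (harmonic_graph f g) (graph_normal f g) z"
  define k2 where "k2 = kappa2 (harmonic_graph f g) (graph_normal f g) z"
  have s: "s > 0" by (auto simp: s_def add_pos_nonneg)
  have p: "p \<noteq> 0" using assms g_imm by (simp add: p_def)
  have k: "k1 + k2 = - Re ((cnj (h z))\<^sup>2 * p) / s ^ 3" "k1 * k2 = - (cmod p)\<^sup>2 / s ^ 4"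
    unfolding k1_def k2_def s_def p_def by (rule curvature_sum_prod)+
  then have "k1 * k2 \<noteq> 0" using s p by simp
  then have "1 / k1 + 1 / k2 = (k1 + k2) / (k1 * k2)"
    by (simp add: field_simps)
  also have "\<dots> = s * (Re ((cnj (h z))\<^sup>2 * p) / (cmod p)\<^sup>2)"
    unfolding k using s p by (simp add: field_simps eval_nat_numeral)
  also have "Re ((cnj (h z))\<^sup>2 * p) / (cmod p)\<^sup>2 = Re ((h z)\<^sup>2 / p)"
  proof -
    have "Re ((h z)\<^sup>2 / p) = Re ((h z)\<^sup>2 * cnj p) / (cmod p)\<^sup>2"
      by (simp add: complex_div_cnj[of _ p] flip: of_real_power)
    also have "Re ((h z)\<^sup>2 * cnj p) = Re (cnj ((h z)\<^sup>2 * cnj p))" by (simp only: complex_cnj cnj.sel)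
    finally show ?thesis by simp
  qed
  also have "(h z)\<^sup>2 / p = (h z)\<^sup>2 * deriv g z / deriv h z"
    by (simp add: p_def)
  finally have "radial_curvature_sum (harmonic_graph f g) (graph_normal f g) z
      = s * Re ((h z)\<^sup>2 * deriv g z / deriv h z)"
    by (simp add: radial_curvature_sum_def k1_def k2_def)
  moreover have "graph_normal f g z \<bullet> e1 = 1 / s"
    by (simp add: graph_normal_eq e1_def s_def)
  ultimately show ?thesis using s by simp
qed

lemma height_eq: "harmonic_graph f g z \<bullet> e1 = Re (f z)"
  by (simp add: harmonic_graph_def e1_def inner_complex_def)

section \<open>Reduction to a complex differential equation\<close>

text \<open>On the nonflat set the equation says that the holomorphic function \<open>h\<^sup>2 g' / h' - (a f + b)\<close> has
real part zero. As the set is connected, this function is a single imaginary constant \<open>i c\<close>.\<close>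
lemma curvature_equation_iff_ode:
  assumes ne: "deriv h p \<noteq> 0"
  shows "(\<forall>z \<in> nonflat_points f g.
            (graph_normal f g z \<bullet> e1)
              * radial_curvature_sum (harmonic_graph f g) (graph_normal f g) z
            = a * (harmonic_graph f g z \<bullet> e1) + b)
     \<longleftrightarrow> (\<exists>c::real. \<forall>z. deriv h z \<noteq> 0 \<longrightarrow> (h z)\<^sup>2 * deriv g z = deriv h z * (a * f z + b + \<i> * c))"
   (is "?L \<longleftrightarrow> (\<exists>c. ?R c)")
proof -
  let ?S = "{z. deriv h z \<noteq> 0}"
  let ?F = "\<lambda>z. (h z)\<^sup>2 * deriv g z / deriv h z - (a * f z + b)"
  have L: "?L \<longleftrightarrow> (\<forall>z\<in>?S. Re (?F z) = 0)"
    unfolding nonflat_points_eq height_eq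
    by (intro ball_cong refl) (auto simp: angle_times_radial_curvature_sum)
  have R: "?R c \<longleftrightarrow> (\<forall>z\<in>?S. ?F z = \<i> * c)" for c :: real
    by (auto simp: field_simps)
  have hol: "deriv h holomorphic_on UNIV" by (intro holomorphic_deriv h_hol open_UNIV)
  have "?F holomorphic_on ?S"
    by (intro holomorphic_intros holomorphic_on_subset[OF hol] holomorphic_on_subset[OF h_hol]
        holomorphic_on_subset[OF f_hol] holomorphic_on_subset[OF holomorphic_deriv[OF g_hol]]) auto
  from holomorphic_Re_zero_imp_const[OF entire_nonzero_set[OF hol ne] this]
  show ?thesis unfolding L R by (metis Re_i_times Im_complex_of_real neg_equal_zero)
qed

text \<open>With \<open>Q = a f + B\<close> one has \<open>Q' = a h g'\<close>, and the equation becomes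
\<open>Q' h - Q h' = (a - 1) g' h\<^sup>2\<close>, which is \<open>(Q / h)' = (a - 1) g'\<close> off the zeros of \<open>h\<close>.\<close>
lemma first_integral:
  assumes ne: "h p \<noteq> 0"
    and ode: "\<And>z. (h z)\<^sup>2 * deriv g z = deriv h z * (a * f z + B)"
  obtains C where "\<And>z. a * f z + B = ((a - 1) * g z + C) * h z"
proof (rule entire_quotient_primitive[of "\<lambda>z. a * f z + B" h "\<lambda>z. (a - 1) * g z" p])
  fix z
  have 1: "deriv (\<lambda>z. a * f z + B) z = a * (h z * deriv g z)"
    by (rule DERIV_imp_deriv) (rule derivative_eq_intros surface_derivs refl | simp)+
  have 2: "deriv (\<lambda>z. (a - 1) * g z) z = (a - 1) * deriv g z"
    by (rule DERIV_imp_deriv) (rule derivative_eq_intros surface_derivs refl | simp)+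
  show "deriv (\<lambda>z. a * f z + B) z * h z - (a * f z + B) * deriv h z
      = deriv (\<lambda>z. (a - 1) * g z) z * (h z)\<^sup>2"
    unfolding 1 2 using ode[of z] by algebra
qed (auto intro!: holomorphic_intros f_hol g_hol h_hol ne that)

text \<open>Differentiating \<open>Q = R h\<close> with \<open>Q' = a h g'\<close> and \<open>R' = (a - 1) g'\<close> leaves \<open>R h' = h g'\<close>; it then remains
to multiply by \<open>h\<close>. No division occurs, so zeros of \<open>h\<close> or \<open>R\<close> do no harm.\<close>
lemma first_integral_imp_ode:
  assumes "open V" "z \<in> V" and eq: "\<And>z. z \<in> V \<Longrightarrow> a * f z + B = ((a - 1) * g z + C) * h z"
  shows "(h z)\<^sup>2 * deriv g z = deriv h z * (a * f z + B)"
proof -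
  let ?R = "(a - 1) * g z + C"
  have "((\<lambda>z. a * f z + B) has_field_derivative a * (h z * deriv g z)) (at z)"
    by (rule derivative_eq_intros surface_derivs refl | simp)+
  moreover have "((\<lambda>z. ((a - 1) * g z + C) * h z) has_field_derivative
      (a - 1) * deriv g z * h z + ?R * deriv h z) (at z)"
    by (rule derivative_eq_intros surface_derivs refl | simp)+
  then have "((\<lambda>z. a * f z + B) has_field_derivative
      (a - 1) * deriv g z * h z + ?R * deriv h z) (at z)"
    by (rule has_field_derivative_transform_within_open[OF _ assms(1,2)]) (simp add: eq)
  ultimately have "a * (h z * deriv g z) = (a - 1) * deriv g z * h z + ?R * deriv h z"
    by (rule DERIV_unique)
  then have "?R * deriv h z = h z * deriv g z" by (simp add: algebra_simps)
  then show ?thesis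
    unfolding eq[OF assms(2)] by (simp add: power2_eq_square mult_ac)
qed

section \<open>Explicit solutions\<close>

text \<open>Writing \<open>\<phi> = z1 g + z2\<close>, each formula satisfies a linear first order equation with the factor
\<open>\<phi>\<close> (or \<open>1 / z2\<close> if \<open>a = 1\<close>) in front of \<open>f'\<close>. Up to a constant multiple that factor is
\<open>R = (a - 1) g + C\<close>, which determines \<open>C\<close>.\<close>
lemma explicit_solution_imp_first_integral:
  assumes "open V" and z1: "z1 \<noteq> 0" and z2: "a = 1 \<Longrightarrow> z2 \<noteq> 0"
    and sol: "explicit_solution_on a b z1 z2 c f g V"
  obtains C where
    "\<And>z. z \<in> V \<Longrightarrow> of_real a * f z + (of_real b + \<i> * of_real c) = ((of_real a - 1) * g z + C) * h z"
proof -
  let ?B = "of_real b + \<i> * of_real c :: complex"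
  let ?\<phi> = "\<lambda>z. z1 * g z + z2"
  have transf: "F' = h z * deriv g z"
    if "z \<in> V" "(F has_field_derivative F') (at z)" "\<And>z. z \<in> V \<Longrightarrow> f z = F z" for z F F'
  proof -
    have "(f has_field_derivative F') (at z)"
      by (rule has_field_derivative_transform_within_open[OF that(2) assms(1) that(1)])
        (simp add: that(3))
    then show ?thesis using surface_derivs(1) DERIV_unique by blast
  qed
  have d\<phi>: "(?\<phi> has_field_derivative z1 * deriv g z) (at z)" for z
    by (rule derivative_eq_intros surface_derivs refl | simp)+
  consider "a = 0" | "a = 1" | "a \<noteq> 0" "a \<noteq> 1" by blast
  then show ?thesis
  proof cases
    case 1
    then obtain L where L: "log_branch_on V ?\<phi> L" and f: "\<And>z. z \<in> V \<Longrightarrow> f z = - ?B * L z"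
      using sol unfolding explicit_solution_on_def by auto
    show ?thesis
    proof (rule that[of "- z2 / z1"])
      fix z assume z: "z \<in> V"
      have dL: "(L has_field_derivative deriv L z) (at z)"
        using L assms(1) z by (auto simp: log_branch_on_def intro: holomorphic_derivI)
      have "((\<lambda>z. exp (L z)) has_field_derivative exp (L z) * deriv L z) (at z)"
        by (rule derivative_eq_intros dL refl)+
      then have "(?\<phi> has_field_derivative exp (L z) * deriv L z) (at z)"
        by (rule has_field_derivative_transform_within_open[OF _ assms(1) z])
          (use L in \<open>auto simp: log_branch_on_def\<close>)
      then have 1: "z1 * deriv g z = ?\<phi> z * deriv L z"
        using DERIV_unique[OF d\<phi>] L z by (auto simp: log_branch_on_def)
      have "((\<lambda>z. - ?B * L z) has_field_derivative - ?B * deriv L z) (at z)"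
        by (rule derivative_eq_intros dL refl | simp)+
      then have 2: "- ?B * deriv L z = h z * deriv g z"
        by (rule transf[OF z]) (rule f)
      have "z1 * deriv g z * ?B = - (?\<phi> z * h z * deriv g z)"
        unfolding 1 mult.assoc 2[symmetric] by (simp add: algebra_simps)
      then have "deriv g z * (z1 * ?B + ?\<phi> z * h z) = 0" by algebra
      then have "z1 * ?B + ?\<phi> z * h z = 0" using g_imm[of z] by simp
      then have "z1 * ?B = z1 * ((- g z + - z2 / z1) * h z)" using z1 by (simp add: field_simps) algebra
      then show "of_real a * f z + ?B = ((of_real a - 1) * g z + - z2 / z1) * h z"
        using z1 by (simp add: \<open>a = 0\<close>)
    qed
  next
    case 2
    then have f: "\<And>z. z \<in> V \<Longrightarrow> f z = z1 * exp (z2 * g z) - ?B"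
      using sol unfolding explicit_solution_on_def by (simp add: algebra_simps)
    show ?thesis
    proof (rule that[of "1 / z2"])
      fix z assume z: "z \<in> V"
      have "((\<lambda>z. z1 * exp (z2 * g z) - ?B) has_field_derivative z1 * (exp (z2 * g z) * (z2 * deriv g z))) (at z)"
        by (rule derivative_eq_intros surface_derivs refl | simp)+
      then have "z1 * (exp (z2 * g z) * (z2 * deriv g z)) = h z * deriv g z"
        by (rule transf[OF z]) (rule f)
      then have "h z = z2 * (z1 * exp (z2 * g z))" using g_imm[of z] by (auto simp: mult_ac)
      then show "of_real a * f z + ?B = ((of_real a - 1) * g z + 1 / z2) * h z"
        using z2 f[OF z] 2 by simp
    qed
  next
    case 3
    then obtain P where P: "power_branch_on V ?\<phi> (a / (a - 1)) P"
      and f: "\<And>z. z \<in> V \<Longrightarrow> f z = (P z - ?B) / of_real a"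
      using sol unfolding explicit_solution_on_def by (auto simp: algebra_simps)
    show ?thesis
    proof (rule that[of "(of_real a - 1) * z2 / z1"])
      fix z assume z: "z \<in> V"
      obtain P' where P': "(P has_field_derivative P') (at z)"
        "?\<phi> z * P' = of_real (a / (a - 1)) * (z1 * deriv g z) * P z"
        using power_branch_on_ode[OF assms(1) z P d\<phi>] .
      have "((\<lambda>z. (P z - ?B) / of_real a) has_field_derivative P' / of_real a) (at z)"
        using 3 by (auto intro!: derivative_eq_intros P')
      then have "P' / of_real a = h z * deriv g z"
        by (rule transf[OF z]) (rule f)
      then have P'_eq: "P' = of_real a * h z * deriv g z" using 3 by (simp add: field_simps)
      have ne: "complex_of_real a - 1 \<noteq> 0" "complex_of_real a \<noteq> 0"
        using 3 by (metis of_real_1 of_real_eq_iff right_minus_eq, simp)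
      have "of_real a * deriv g z * ((of_real a - 1) * ?\<phi> z * h z) = of_real a * deriv g z * (z1 * P z)"
        using P'(2) ne unfolding P'_eq by (simp add: field_simps)
      then have "(of_real a - 1) * ?\<phi> z * h z = z1 * P z"
        using ne(2) g_imm[of z] by simp
      then have "P z = (of_real a - 1) * ?\<phi> z * h z / z1" using z1 by (simp add: field_simps)
      moreover have "of_real a * f z + ?B = P z" using f[OF z] ne by simp
      ultimately show "of_real a * f z + ?B = ((of_real a - 1) * g z + (of_real a - 1) * z2 / z1) * h z"
        using z1 by (simp add: field_simps)
    qed
  qed
qed

text \<open>The assumption amounts to \<open>R f' = g' Q\<close> with \<open>R = (a - 1) g + C\<close>. For \<open>a = 0\<close> the functions
\<open>exp (- f / B)\<close> and \<open>R\<close> have vanishing Wronskian, for \<open>a = 1\<close> the functions \<open>Q\<close> and \<open>exp (g / C)\<close>,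
and otherwise \<open>R Q' = k R' Q\<close> with \<open>k = a / (a - 1)\<close>. The formulas hold on the whole plane, so one
choice of constants serves all nonflat points.\<close>
lemma first_integral_imp_explicit_solution:
  fixes a b c :: real
  defines "B \<equiv> of_real b + \<i> * of_real c :: complex"
  assumes fi: "\<And>z. of_real a * f z + B = ((of_real a - 1) * g z + C) * h z"
    and ne: "of_real a * f p + B \<noteq> 0"
  shows "\<exists>z1 z2. z1 \<noteq> 0 \<and> (a = 1 \<longrightarrow> z2 \<noteq> 0) \<and> explicit_solution_on a b z1 z2 c f g UNIV"
proof -
  let ?Q = "\<lambda>z. of_real a * f z + B" and ?R = "\<lambda>z. (of_real a - 1) * g z + C"
  have hol: "?Q holomorphic_on UNIV" "?R holomorphic_on UNIV"
    by (intro holomorphic_intros f_hol g_hol)+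
  have dQ: "(?Q has_field_derivative of_real a * (h z * deriv g z)) (at z)" for z
    by (rule derivative_eq_intros surface_derivs refl | simp)+
  have dR: "(?R has_field_derivative (of_real a - 1) * deriv g z) (at z)" for z
    by (rule derivative_eq_intros surface_derivs refl | simp)+
  have R_p: "?R p \<noteq> 0" using ne fi[of p] by auto
  consider "a = 0" | "a = 1" | "a \<noteq> 0" "a \<noteq> 1" by blast
  then show ?thesis
  proof cases
    case 1
    have B: "B \<noteq> 0" "B = (C - g z) * h z" for z using fi[of z] ne 1 by auto
    \<comment> \<open>\<open>- f / B\<close> is itself the logarithm; no branch has to be chosen\<close>
    define L where "L z = - f z / B" for z
    have L: "L holomorphic_on UNIV" unfolding L_def by (intro holomorphic_intros f_hol B)
    obtain D where D: "\<And>z. exp (L z) = (0 + D) * (C - g z)"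
    proof (rule entire_quotient_primitive[of "\<lambda>z. exp (L z)" "\<lambda>z. C - g z" "\<lambda>z. 0" p])
      fix z
      have 1: "deriv (\<lambda>z. exp (L z)) z = exp (L z) * (- (h z * deriv g z) / B)"
        unfolding L_def by (rule DERIV_imp_deriv) (rule derivative_eq_intros surface_derivs refl B | simp)+
      have 2: "deriv (\<lambda>z. C - g z) z = - deriv g z"
        by (rule DERIV_imp_deriv) (rule derivative_eq_intros surface_derivs refl | simp)+
      have "h z * (C - g z) / B = 1" using B(1) B(2)[of z] by (metis mult.commute divide_self)
      then have 3: "- (h z * deriv g z) / B * (C - g z) = - deriv g z"
        using B(1) by (simp add: field_simps)
      show "deriv (\<lambda>z. exp (L z)) z * (C - g z) - exp (L z) * deriv (\<lambda>z. C - g z) z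
          = deriv (\<lambda>z. 0) z * (C - g z)\<^sup>2"
        unfolding 1 2 mult.assoc 3 by simp
    qed (use R_p 1 in \<open>auto intro!: holomorphic_intros L g_hol\<close>)
    have "D \<noteq> 0" using D[of p] by auto
    have "log_branch_on UNIV (\<lambda>z. - D * g z + D * C) L"
      unfolding log_branch_on_def using L D by (auto simp: algebra_simps)
    moreover have "f z = - (of_real b + \<i> * of_real c) * L z" for z
      using B(1) by (simp add: L_def flip: B_def)
    ultimately have "explicit_solution_on a b (- D) (D * C) c f g UNIV"
      unfolding explicit_solution_on_def using 1 by auto
    with \<open>D \<noteq> 0\<close> 1 show ?thesis by (intro exI[of _ "- D"] exI[of _ "D * C"]) auto
  next
    case 2
    then have C: "C \<noteq> 0" using R_p by auto
    have Q: "f z + B = C * h z" for z using fi[of z] 2 by simp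
    let ?v = "\<lambda>z. exp (1 / C * g z)"
    obtain D where D: "\<And>z. f z + B = (0 + D) * ?v z"
    proof (rule entire_quotient_primitive[of "\<lambda>z. f z + B" ?v "\<lambda>z. 0" p])
      fix z
      have 1: "deriv (\<lambda>z. f z + B) z = h z * deriv g z"
        by (rule DERIV_imp_deriv) (rule derivative_eq_intros surface_derivs refl | simp)+
      have 2: "deriv ?v z = ?v z * (1 / C * deriv g z)"
        by (rule DERIV_imp_deriv) (rule derivative_eq_intros surface_derivs refl C | simp)+
      show "deriv (\<lambda>z. f z + B) z * ?v z - (f z + B) * deriv ?v z = deriv (\<lambda>z. 0) z * (?v z)\<^sup>2"
        unfolding 1 2 using Q[of z] C by simp
    qed (auto intro!: holomorphic_intros f_hol g_hol)
    have "D \<noteq> 0" using D[of p] ne 2 by auto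
    have "f z = D * exp (1 / C * g z) - of_real b - \<i> * of_real c" for z
      using D[of z] by (simp add: B_def algebra_simps)
    then have "explicit_solution_on a b D (1 / C) c f g UNIV"
      unfolding explicit_solution_on_def using 2 by auto
    with \<open>D \<noteq> 0\<close> C show ?thesis by (intro exI[of _ D] exI[of _ "1 / C"]) auto
  next
    case 3
    have a1: "complex_of_real a - 1 \<noteq> 0"
      using 3 by (metis of_real_1 of_real_eq_iff right_minus_eq)
    have ka: "complex_of_real (a / (a - 1)) * (of_real a - 1) = of_real a"
      using a1 by simp
    have ring: "R * (A * (x * y)) = K * (A' * y) * (R * x)" if "K * A' = A"
      for A A' K R x y :: complex
      unfolding that[symmetric] by (simp add: mult_ac)
    obtain l where l: "l \<noteq> 0" "power_branch_on UNIV (\<lambda>z. l * ?R z) (a / (a - 1)) ?Q"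
    proof (rule entire_power_ode[OF hol(2,1) _ ne, of "a / (a - 1)"])
      fix z
      show "deriv ?R z \<noteq> 0" using DERIV_imp_deriv[OF dR] a1 g_imm by simp
      show "?R z * deriv ?Q z = of_real (a / (a - 1)) * deriv ?R z * ?Q z"
        unfolding DERIV_imp_deriv[OF dR] DERIV_imp_deriv[OF dQ]
        unfolding fi by (rule ring[OF ka])
    qed (use 3 in auto)
    let ?z1 = "l * (of_real a - 1)" and ?z2 = "l * C"
    have "(\<lambda>z. l * ?R z) = (\<lambda>z. ?z1 * g z + ?z2)" by (auto simp: algebra_simps)
    then have "power_branch_on UNIV (\<lambda>z. ?z1 * g z + ?z2) (a / (a - 1)) ?Q"
      using l(2) by simp
    moreover have "f z = (?Q z - of_real b - \<i> * of_real c) / of_real a" for z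
      using 3 by (simp add: B_def)
    ultimately have "explicit_solution_on a b ?z1 ?z2 c f g UNIV"
      unfolding explicit_solution_on_def using 3 by auto
    with l(1) a1 3 show ?thesis by (intro exI[of _ ?z1] exI[of _ ?z2]) auto
  qed
qed

lemma explicit_solution_on_subset:
  assumes "explicit_solution_on a b z1 z2 c f g V" "W \<subseteq> V"
  shows "explicit_solution_on a b z1 z2 c f g W"
proof -
  have log: "log_branch_on W \<phi> L" if "log_branch_on V \<phi> L" for \<phi> L
    using that assms(2) by (auto simp: log_branch_on_def elim: holomorphic_on_subset)
  have power: "power_branch_on W \<phi> k P" if "power_branch_on V \<phi> k P" for \<phi> k P
    using that log assms(2) unfolding power_branch_on_def by (elim disjE exE conjE) blast+
  show ?thesis
    using assms log power unfolding explicit_solution_on_def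
    by (smt (verit) subsetD)
qed

end

theorem theorem4p3:
  fixes f g :: "complex \<Rightarrow> complex" and a b :: real
  assumes "f holomorphic_on UNIV"
    and "g holomorphic_on UNIV"
    and "\<And>z. deriv g z \<noteq> 0"
  shows "(\<forall>z \<in> nonflat_points f g.
            (graph_normal f g z \<bullet> e1)
              * radial_curvature_sum (harmonic_graph f g) (graph_normal f g) z
            = a * (harmonic_graph f g z \<bullet> e1) + b)
     \<longleftrightarrow>
         (\<exists>(z1::complex) (z2::complex) (c::real).
            z1 \<noteq> 0 \<and> (a = 1 \<longrightarrow> z2 \<noteq> 0) \<and>
            (\<forall>z0 \<in> nonflat_points f g.
               \<exists>V. open V \<and> simply_connected V \<and> z0 \<in> V \<and> V \<subseteq> nonflat_points f g \<and>
                   explicit_solution_on a b z1 z2 c f g V))"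
    (is "?curv \<longleftrightarrow> ?expl")
proof (cases "nonflat_points f g = {}")
  case True
  then show ?thesis by (auto intro!: exI[of _ 1])
next
  case False
  interpret immersed_graph f g by unfold_locales (rule assms)+
  obtain p where p: "deriv h p \<noteq> 0" using False by (auto simp: nonflat_points_eq)
  have h'_hol: "deriv h holomorphic_on UNIV" by (intro holomorphic_deriv h_hol open_UNIV)
  note S = entire_nonzero_set[OF h'_hol p]
  have ode: "?curv \<longleftrightarrow> (\<exists>c::real. \<forall>z. deriv h z \<noteq> 0 \<longrightarrow>
      (h z)\<^sup>2 * deriv g z = deriv h z * (a * f z + b + \<i> * c))"
    by (rule curvature_equation_iff_ode[OF p])
  show ?thesis
  proof
    assume ?curv
    then obtain c :: real where c: "\<And>z. deriv h z \<noteq> 0 \<Longrightarrow>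
      (h z)\<^sup>2 * deriv g z = deriv h z * (a * f z + b + \<i> * c)"
      using ode by blast
    let ?B = "of_real b + \<i> * of_real c :: complex"
    \<comment> \<open>the equation extends to the flat points, so that it can be integrated on the whole plane\<close>
    have c': "(h z)\<^sup>2 * deriv g z = deriv h z * (of_real a * f z + ?B)" for z
    proof (rule analytic_continuation_open[OF S(1) open_UNIV _ connected_UNIV subset_UNIV, where z=z])
      show "{z. deriv h z \<noteq> 0} \<noteq> {}" using p by blast
    qed (auto intro!: holomorphic_intros h_hol g_hol f_hol h'_hol simp: c add.assoc)
    \<comment> \<open>a nonzero value of \<open>h\<close> at a nonflat point makes \<open>Q\<close> nonzero there\<close>
    obtain q where q: "deriv h q \<noteq> 0" "h q \<noteq> 0"
    proof -
      have "\<exists>q\<in>{z. deriv h z \<noteq> 0}. h q \<noteq> 0"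
      proof (rule ccontr)
        assume "\<not> ?thesis"
        then have "(h has_field_derivative 0) (at p)"
          by (intro has_field_derivative_transform_within_open[OF DERIV_const S(1), of p 0]) (use p in auto)
        then show False using p DERIV_imp_deriv by blast
      qed
      then show ?thesis using that by blast
    qed
    obtain C where C: "\<And>z. of_real a * f z + ?B = ((of_real a - 1) * g z + C) * h z"
      using first_integral[OF q(2) c'] by blast
    have "of_real a * f q + ?B \<noteq> 0"
      using c'[of q] q g_imm[of q] by auto
    from first_integral_imp_explicit_solution[OF C this]
    obtain z1 z2 where z: "z1 \<noteq> 0" "a = 1 \<longrightarrow> z2 \<noteq> 0" "explicit_solution_on a b z1 z2 c f g UNIV"
      by blast
    have "\<exists>V. open V \<and> simply_connected V \<and> z0 \<in> V \<and> V \<subseteq> nonflat_points f g \<and>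
                   explicit_solution_on a b z1 z2 c f g V" if z0: "z0 \<in> nonflat_points f g" for z0
    proof -
      have open_nf: "open (nonflat_points f g)"
        using S(1) by (simp only: nonflat_points_eq)
      obtain r where "r > 0" "ball z0 r \<subseteq> nonflat_points f g"
        using open_nf z0 by (rule openE)
      then show ?thesis
        by (intro exI[of _ "ball z0 r"] conjI open_ball convex_imp_simply_connected convex_ball
            explicit_solution_on_subset[OF z(3) subset_UNIV]) simp_all
    qed
    with z(1,2) show ?expl by blast
  next
    assume ?expl
    then obtain z1 z2 c where z: "z1 \<noteq> 0" "a = 1 \<longrightarrow> z2 \<noteq> 0"
      and expl: "\<forall>z0\<in>nonflat_points f g. \<exists>V. open V \<and> simply_connected V \<and> z0 \<in> V \<and>
        V \<subseteq> nonflat_points f g \<and> explicit_solution_on a b z1 z2 c f g V"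
      by blast
    have "(h z)\<^sup>2 * deriv g z = deriv h z * (a * f z + b + \<i> * c)" if nf: "deriv h z \<noteq> 0" for z
    proof -
      obtain V where V: "open V" "z \<in> V" "explicit_solution_on a b z1 z2 c f g V"
        using bspec[OF expl, of z] nf by (auto simp: nonflat_points_eq)
      obtain C where "\<And>w. w \<in> V \<Longrightarrow>
          of_real a * f w + (of_real b + \<i> * of_real c) = ((of_real a - 1) * g w + C) * h w"
        using explicit_solution_imp_first_integral[OF V(1) z(1) _ V(3)] z(2) by blast
      from first_integral_imp_ode[OF V(1,2) this] show ?thesis by (simp add: add.assoc)
    qed
    then show ?curv using ode by blast
  qed
qed

end
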